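(* Let $n\ge 2$, let $\sigma=-1$, and let $B>0$ and masses $\widehat m_1,\dots,\widehat m_n>0$ be fixed. Then for every order of the masses there exists at most one equivalence class of polygonal relative equilibria, with rotation constant $B$, of the system $$\ddot p_i=\sum_{j=1,\ j\neq i}^{n}\frac{\widehat m_j\,\bigl(p_j-\sigma(p_i\odot p_j)p_i\bigr)}{\bigl(\sigma-\sigma(p_i\odot p_j)^2\bigr)^{3/2}}-\sigma(\dot p_i\odot\dot p_i)p_i,\qquad i\in\{1,\dots,n\},\quad p_i\in\mathbb{M}_\sigma^2 .$$ That is: if $(p_1,\dots,p_n)$ and $(p_1',\dots,p_n')$ are two polygonal relative equilibria of this system with $\sigma=-1$, with the same masses $\widehat m_1,\dots,\widehat m_n$, the same $B$, and the same order of the masses, then they are equivalent.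
   Context: For $\sigma=\pm1$, $\mathbb{M}_\sigma^2=\{(x_1,x_2,x_3)\in\mathbb{R}^3 : x_1^2+x_2^2+\sigma x_3^2=\sigma\}$, and for $x,y\in\mathbb{R}^3$, $x\odot y=x_1y_1+x_2y_2+\sigma x_3y_3$. Here $\sigma=-1$ (negative curvature). Also $T(t)=\begin{pmatrix}\cos t&-\sin t\\ \sin t&\cos t\end{pmatrix}$. A polygonal relative equilibrium (with rotation constant $B>0$) is a solution $p_1,\dots,p_n\in\mathbb{M}_\sigma^2$ of the system of the form $p_i(t)=\begin{pmatrix}T(Bt)P_i\\ z\end{pmatrix}$, $i\in\{1,\dots,n\}$, where $P_i\in\mathbb{R}^2$ and $z\in\mathbb{R}$ are constant, $z$ being the same for all $i$. The points are pairwise distinct (no collisions); all $P_i$ then have the same norm $\rho>0$. Order of the masses: given a permutation $\tau$ of $\{1,\dots,n\}$, a polygonal relative equilibrium has the masses in the order $\tau$ if, after a rotation of $\mathbb{R}^2$, $P_{\tau(k)}=\rho(\cos\gamma_k,\sin\gamma_k)^T$ for $k=1,\dots,n$ with $\rho>0$ and $0\le\gamma_1<\gamma_2<\dots<\gamma_n<2\pi$. Equivalence: two polygonal relative equilibria $(p_i)$ and $(p_i')$ are equivalent (in the same equivalence class) if there is a constant $c\in\mathbb{R}$ such that $p_i'=\begin{pmatrix}T(c)&\mathbf 0\\ \mathbf 0^T&1\end{pmatrix}p_i$ for all $i$, where $\mathbf 0\in\mathbb{R}^2$ is the zero vector.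
   Formalization: Added assumption: both relative equilibria lie on the same sheet of the hyperboloid (z and z' have the same sign); otherwise reflecting x_3 to -x_3 gives an inequivalent equilibrium with the same masses, B and order. *)

theory Defs
  imports "HOL-Analysis.Analysis" "HOL-Combinatorics.Permutations"
begin

definition M2 :: "real \<Rightarrow> (real ^ 3) set" where
  "M2 \<sigma> = {x. (x $ 1)\<^sup>2 + (x $ 2)\<^sup>2 + \<sigma> * (x $ 3)\<^sup>2 = \<sigma>}"

definition odot :: "real \<Rightarrow> real ^ 3 \<Rightarrow> real ^ 3 \<Rightarrow> real" where
  "odot \<sigma> x y = x $ 1 * y $ 1 + x $ 2 * y $ 2 + \<sigma> * x $ 3 * y $ 3"

definition T :: "real \<Rightarrow> real ^ 2 ^ 2" where
  "T t = vector [vector [cos t, - sin t], vector [sin t, cos t]]"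

text \<open>The vector with first two entries \<open>x\<close> and third entry \<open>z\<close>.\<close>

definition stack :: "real ^ 2 \<Rightarrow> real \<Rightarrow> real ^ 3" where
  "stack x z = vector [x $ 1, x $ 2, z]"

text \<open>The block matrix with diagonal blocks \<open>T c\<close> and \<open>1\<close>.\<close>

definition T3 :: "real \<Rightarrow> real ^ 3 ^ 3" where
  "T3 c = vector [stack (T c $ 1) 0, stack (T c $ 2) 0, vector [0, 0, 1]]"

text \<open>
  Solutions, for all times, of the \<open>n\<close>-body problem on \<open>M2 \<sigma>\<close>; the bodies are indexed by
  \<open>{1..n}\<close>, and \<open>v\<close>, \<open>a\<close> are the velocities and accelerations. The positivity condition is the
  domain of the right-hand side: outside of it \<open>powr\<close> and division would
  take conventional values.
\<close>

definition solution :: "nat \<Rightarrow> real \<Rightarrow> (nat \<Rightarrow> real) \<Rightarrow> (nat \<Rightarrow> real \<Rightarrow> real ^ 3) \<Rightarrow> bool" where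
  "solution n \<sigma> m p \<longleftrightarrow>
    (\<forall>i\<in>{1..n}. \<forall>t. p i t \<in> M2 \<sigma>) \<and>
    (\<forall>i\<in>{1..n}. \<forall>j\<in>{1..n} - {i}. \<forall>t. 0 < \<sigma> - \<sigma> * (odot \<sigma> (p i t) (p j t))\<^sup>2) \<and>
    (\<exists>v a. \<forall>i\<in>{1..n}. \<forall>t.
       (p i has_vector_derivative v i t) (at t) \<and>
       (v i has_vector_derivative a i t) (at t) \<and>
       a i t =
         (\<Sum>j\<in>{1..n} - {i}.
            (m j / (\<sigma> - \<sigma> * (odot \<sigma> (p i t) (p j t))\<^sup>2) powr (3 / 2)) *\<^sub>R
            (p j t - (\<sigma> * odot \<sigma> (p i t) (p j t)) *\<^sub>R p i t))
         - (\<sigma> * odot \<sigma> (v i t) (v i t)) *\<^sub>R p i t)"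

definition polygonal_rel_eq ::
  "nat \<Rightarrow> real \<Rightarrow> (nat \<Rightarrow> real) \<Rightarrow> real \<Rightarrow> (nat \<Rightarrow> real ^ 2) \<Rightarrow> real \<Rightarrow> (nat \<Rightarrow> real \<Rightarrow> real ^ 3) \<Rightarrow> bool"
  where
  "polygonal_rel_eq n \<sigma> m B P z p \<longleftrightarrow>
    solution n \<sigma> m p \<and> inj_on P {1..n} \<and>
    (\<forall>i\<in>{1..n}. \<forall>t. p i t = stack (T (B * t) *v P i) z)"

definition mass_order :: "nat \<Rightarrow> (nat \<Rightarrow> nat) \<Rightarrow> (nat \<Rightarrow> real ^ 2) \<Rightarrow> bool" where
  "mass_order n \<tau> P \<longleftrightarrow>
    (\<exists>\<theta> \<rho> \<gamma>. \<rho> > 0 \<and>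
       (\<forall>k\<in>{1..n}. T \<theta> *v P (\<tau> k) = \<rho> *\<^sub>R vector [cos (\<gamma> k), sin (\<gamma> k)] \<and>
                    0 \<le> \<gamma> k \<and> \<gamma> k < 2 * pi) \<and>
       strict_mono_on {1..n} \<gamma>)"

definition equivalent ::
  "nat \<Rightarrow> (nat \<Rightarrow> real \<Rightarrow> real ^ 3) \<Rightarrow> (nat \<Rightarrow> real \<Rightarrow> real ^ 3) \<Rightarrow> bool" where
  "equivalent n p p' \<longleftrightarrow> (\<exists>c. \<forall>i\<in>{1..n}. \<forall>t. p' i t = T3 c *v p i t)"

text \<open>
  For \<open>\<sigma> = -1\<close> the set \<open>M2 \<sigma>\<close> is a hyperboloid of two sheets, distinguished by the sign of the
  third coordinate. Reflection of the third coordinate maps polygonal relative equilibria to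
  polygonal relative equilibria, but \<open>equivalent\<close> fixes the third coordinate; so relative
  equilibria can only be compared if they lie on the same sheet.
\<close>

definition same_sheet :: "real \<Rightarrow> real \<Rightarrow> bool" where
  "same_sheet z z' \<longleftrightarrow> (0 < z \<longleftrightarrow> 0 < z')"

end

theory Submission
  imports Defs
begin

text \<open>
  Write the bodies in polar coordinates with common radius \<open>\<rho>\<close> and angles \<open>\<alpha>\<^sub>i\<close>, and put
  \<open>S\<^sub>i\<^sub>j = \<rho> \<bar>sin ((\<alpha>\<^sub>j - \<alpha>\<^sub>i) / 2)\<bar>\<close>, which is \<open>sinh\<close> of half the hyperbolic
  distance of bodies \<open>i\<close> and \<open>j\<close>. The equations of motion say that \<open>(ln \<rho>, \<alpha>)\<close> is a
  critical point of the amended potential, i.e. the sum over all pairs of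
  \<open>m\<^sub>i m\<^sub>j\<close> times the hyperbolic cotangent of their distance, plus \<open>B\<^sup>2 \<rho>\<^sup>2 / 2\<close> times
  the total mass. The pair term is a convex decreasing function of
  \<open>ln S\<^sub>i\<^sub>j = ln \<rho> + ln \<bar>sin ((\<alpha>\<^sub>j - \<alpha>\<^sub>i) / 2)\<bar>\<close>, which is jointly concave in \<open>(ln \<rho>, \<alpha>)\<close>
  as long as the order of the bodies is kept. So the amended potential is jointly convex, and its
  critical points for a given order differ only by a rotation.
\<close>

section \<open>Reduced equations for the radius and the angles\<close>

definition chord :: "real \<Rightarrow> (nat \<Rightarrow> real) \<Rightarrow> nat \<Rightarrow> nat \<Rightarrow> real" where
  "chord \<rho> \<alpha> i j = \<rho> * \<bar>sin ((\<alpha> j - \<alpha> i) / 2)\<bar>"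

text \<open>If \<open>S = sinh (r / 2)\<close>, then the derivative of \<open>coth r\<close> with respect to \<open>ln S\<close> is \<open>- kap S / 2\<close>.\<close>

definition kap :: "real \<Rightarrow> real" where
  "kap S = 1 / (S * (1 + S\<^sup>2) powr (3 / 2))"

text \<open>The second family says that the derivatives of the amended potential in the angles
  vanish. The first holds for every body separately; its mass-weighted sum is the derivative in
  \<open>ln \<rho>\<close>.\<close>

definition balanced :: "nat set \<Rightarrow> (nat \<Rightarrow> real) \<Rightarrow> real \<Rightarrow> real \<Rightarrow> (nat \<Rightarrow> real) \<Rightarrow> bool" where
  "balanced I m B \<rho> \<alpha> \<longleftrightarrow> \<rho> > 0 \<and>
    (\<forall>i\<in>I. (\<Sum>j\<in>I - {i}. m j * kap (chord \<rho> \<alpha> i j)) = 4 * B\<^sup>2 * \<rho>\<^sup>2) \<and>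
    (\<forall>i\<in>I. (\<Sum>j\<in>I - {i}. m j * kap (chord \<rho> \<alpha> i j) * cot ((\<alpha> j - \<alpha> i) / 2)) = 0)"

text \<open>Only differences enter, so each configuration may be rotated on its own. The bound
  \<open>2 * pi\<close> keeps every half-difference on one branch of the logarithm of the absolute
  sine, where that function is concave.\<close>

definition same_order :: "nat set \<Rightarrow> (nat \<Rightarrow> real) \<Rightarrow> (nat \<Rightarrow> real) \<Rightarrow> bool" where
  "same_order I \<alpha> \<beta> \<longleftrightarrow> (\<forall>i\<in>I. \<forall>j\<in>I - {i}.
     (\<alpha> j - \<alpha> i \<in> {0<..<2 * pi} \<and> \<beta> j - \<beta> i \<in> {0<..<2 * pi}) \<or>
     (\<alpha> i - \<alpha> j \<in> {0<..<2 * pi} \<and> \<beta> i - \<beta> j \<in> {0<..<2 * pi}))"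

lemma same_order_sym: "same_order I \<alpha> \<beta> \<Longrightarrow> same_order I \<beta> \<alpha>"
  unfolding same_order_def by blast

section \<open>Concavity of the logarithm of the sine\<close>

text \<open>The function \<open>- ln (sin u)\<close> has second derivative
  \<open>1 / (sin u)\<^sup>2\<close> on the interval from \<open>0\<close> to \<open>pi\<close>, so
  it is convex and lies above its tangents.\<close>

lemma ln_sin_le_tangent:
  fixes x y :: real
  assumes "0 < x" "x < pi" "0 < y" "y < pi"
  shows "ln (sin y) \<le> ln (sin x) + cot x * (y - x)"
proof -
  have "- cot x * (y - x) \<le> - ln (sin y) - - ln (sin x)"
  proof (rule f''_imp_f'[where C = "{0<..<pi}" and f'' = "\<lambda>u. inverse ((sin u)\<^sup>2)"])
    fix u :: real assume u: "u \<in> {0<..<pi}"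
    then have s: "sin u > 0" by (simp add: sin_gt_zero)
    show "((\<lambda>u. - ln (sin u)) has_real_derivative - cot u) (at u)"
      using s by (auto intro!: derivative_eq_intros simp: cot_def field_simps)
    show "((\<lambda>u. - cot u) has_real_derivative inverse ((sin u)\<^sup>2)) (at u)"
      using DERIV_minus[OF DERIV_cot, of u] s by simp
    show "inverse ((sin u)\<^sup>2) \<ge> 0" by simp
  qed (use assms in auto)
  then show ?thesis by simp
qed

text \<open>Negative differences reduce to positive ones, because the absolute sine is even and the
  cotangent is odd.\<close>

lemma ln_abs_sin_half_le_tangent:
  fixes d e :: real
  assumes "(d \<in> {0<..<2 * pi} \<and> e \<in> {0<..<2 * pi}) \<or>
    (- d \<in> {0<..<2 * pi} \<and> - e \<in> {0<..<2 * pi})"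
  shows "ln \<bar>sin (e / 2)\<bar> \<le> ln \<bar>sin (d / 2)\<bar> + cot (d / 2) * (e - d) / 2"
proof -
  have pos: "ln \<bar>sin (e / 2)\<bar> \<le> ln \<bar>sin (d / 2)\<bar> + cot (d / 2) * (e - d) / 2"
    if "d \<in> {0<..<2 * pi}" "e \<in> {0<..<2 * pi}" for d e :: real
    using that ln_sin_le_tangent[of "d / 2" "e / 2"] sin_gt_zero[of "d / 2"] sin_gt_zero[of "e / 2"]
    by (simp add: field_simps)
  show ?thesis using assms
  proof
    assume "- d \<in> {0<..<2 * pi} \<and> - e \<in> {0<..<2 * pi}"
    with pos[of "- d" "- e"] show ?thesis by (simp add: field_simps)
  qed (use pos in blast)
qed

lemma abs_sin_half_pos:
  assumes "d \<in> {0<..<2 * pi} \<or> - d \<in> {0<..<2 * pi}"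
  shows "0 < \<bar>sin (d / 2)\<bar>"
  using assms sin_gt_zero[of "d / 2"] sin_gt_zero[of "- d / 2"] by auto

lemma chord_pos:
  assumes "same_order I \<alpha> \<beta>" "i \<in> I" "j \<in> I - {i}" "\<rho> > 0"
  shows "chord \<rho> \<alpha> i j > 0"
proof -
  have "0 < \<bar>sin ((\<alpha> j - \<alpha> i) / 2)\<bar>"
    by (rule abs_sin_half_pos) (use assms in \<open>auto simp: same_order_def\<close>)
  then show ?thesis using assms(4) by (simp only: chord_def mult_pos_pos)
qed

section \<open>Monotonicity of the pair force\<close>

lemma one_plus_square_neq_zero [simp]: "1 + S\<^sup>2 \<noteq> (0 :: real)"
  by (smt (verit) zero_le_power2)

lemma kap_pos: "S > 0 \<Longrightarrow> kap S > 0"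
  by (simp add: kap_def)

text \<open>Both factors of the denominator grow with \<open>S\<close>. In the variable
  \<open>ln S\<close> this is the strict convexity of the pair potential.\<close>

lemma kap_strict_antimono:
  assumes "0 < S" "S < R"
  shows "kap R < kap S"
proof -
  have "1 + S\<^sup>2 \<le> 1 + R\<^sup>2" using assms by (simp add: power_mono)
  then have "(1 + S\<^sup>2) powr (3 / 2) \<le> (1 + R\<^sup>2) powr (3 / 2)"
    by (intro powr_mono2) auto
  moreover have "0 < (1 + S\<^sup>2) powr (3 / 2)"
    by simp
  ultimately have "S * (1 + S\<^sup>2) powr (3 / 2) < R * (1 + R\<^sup>2) powr (3 / 2)"
    using assms by (intro mult_less_le_imp_less) auto
  then show ?thesis
    unfolding kap_def using assms \<open>0 < (1 + S\<^sup>2) powr (3 / 2)\<close>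
    by (intro divide_strict_left_mono mult_pos_pos) auto
qed

lemma kap_ln_monotone:
  assumes "0 < S" "0 < R"
  shows "(kap S - kap R) * (ln R - ln S) \<ge> 0"
    and "(kap S - kap R) * (ln R - ln S) = 0 \<Longrightarrow> S = R"
  using assms kap_strict_antimono[of S R] kap_strict_antimono[of R S]
  by (cases S R rule: linorder_cases; auto simp: zero_le_mult_iff)+

section \<open>Convexity argument for balanced configurations\<close>

text \<open>Filling the diagonal with zeros makes the inner index set independent of the outer
  index, so the sums can be exchanged.\<close>

lemma sum_swap_off_diagonal:
  fixes f :: "nat \<Rightarrow> nat \<Rightarrow> real"
  assumes "finite I"
  shows "(\<Sum>i\<in>I. \<Sum>j\<in>I - {i}. f i j) = (\<Sum>i\<in>I. \<Sum>j\<in>I - {i}. f j i)"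
proof -
  have "(\<Sum>i\<in>I. \<Sum>j\<in>I - {i}. f i j) = (\<Sum>i\<in>I. \<Sum>j\<in>I. if j = i then 0 else f i j)"
    for f :: "nat \<Rightarrow> nat \<Rightarrow> real"
    using assms by (intro sum.cong refl sum.mono_neutral_cong_left) auto
  note eq = this
  show ?thesis
    unfolding eq by (subst sum.swap) (intro sum.cong refl, auto)
qed

text \<open>The concavity defect of the logarithm of the chord: its linearisation at the unprimed
  configuration, applied to the displacement, minus its true increment.\<close>

definition gap :: "real \<Rightarrow> (nat \<Rightarrow> real) \<Rightarrow> real \<Rightarrow> (nat \<Rightarrow> real) \<Rightarrow> nat \<Rightarrow> nat \<Rightarrow> real" where
  "gap \<rho> \<alpha> \<rho>' \<alpha>' i j = ln \<rho>' - ln \<rho> +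
     cot ((\<alpha> j - \<alpha> i) / 2) * ((\<alpha>' j - \<alpha> j) - (\<alpha>' i - \<alpha> i)) / 2
     - (ln (chord \<rho>' \<alpha>' i j) - ln (chord \<rho> \<alpha> i j))"

text \<open>The logarithm of the chord is \<open>ln \<rho>\<close> plus a function of the angle
  difference. The linear part \<open>ln \<rho>\<close> cancels and the tangent inequality for the
  sine remains.\<close>

lemma gap_nonneg:
  assumes "same_order I \<alpha> \<alpha>'" "i \<in> I" "j \<in> I - {i}" "\<rho> > 0" "\<rho>' > 0"
  shows "gap \<rho> \<alpha> \<rho>' \<alpha>' i j \<ge> 0"
proof -
  have o: "(\<alpha> j - \<alpha> i \<in> {0<..<2 * pi} \<and> \<alpha>' j - \<alpha>' i \<in> {0<..<2 * pi}) \<or>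
    (- (\<alpha> j - \<alpha> i) \<in> {0<..<2 * pi} \<and> - (\<alpha>' j - \<alpha>' i) \<in> {0<..<2 * pi})"
    using assms(1-3) by (auto simp: same_order_def)
  have "0 < \<bar>sin ((\<alpha> j - \<alpha> i) / 2)\<bar>" "0 < \<bar>sin ((\<alpha>' j - \<alpha>' i) / 2)\<bar>"
    using o abs_sin_half_pos by blast+
  then have "ln (chord \<rho> \<alpha> i j) = ln \<rho> + ln \<bar>sin ((\<alpha> j - \<alpha> i) / 2)\<bar>"
    "ln (chord \<rho>' \<alpha>' i j) = ln \<rho>' + ln \<bar>sin ((\<alpha>' j - \<alpha>' i) / 2)\<bar>"
    using assms(4,5) unfolding chord_def by (simp_all only: ln_mult_pos)
  with ln_abs_sin_half_le_tangent[OF o] show ?thesis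
    unfolding gap_def by (simp add: algebra_simps)
qed

text \<open>
  In the directional derivative of the pair potential at a balanced configuration, only the
  radial direction contributes.
\<close>

lemma sum_gap:
  assumes "finite I" "balanced I m B \<rho> \<alpha>"
  shows "(\<Sum>i\<in>I. \<Sum>j\<in>I - {i}. m i * m j * kap (chord \<rho> \<alpha> i j) * gap \<rho> \<alpha> \<rho>' \<alpha>' i j) =
    (ln \<rho>' - ln \<rho>) * (4 * B\<^sup>2 * \<rho>\<^sup>2) * sum m I -
    (\<Sum>i\<in>I. \<Sum>j\<in>I - {i}. m i * m j * kap (chord \<rho> \<alpha> i j) *
       (ln (chord \<rho>' \<alpha>' i j) - ln (chord \<rho> \<alpha> i j)))"
proof -
  define K where "K i j = kap (chord \<rho> \<alpha> i j)" for i j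
  define c where "c i j = cot ((\<alpha> j - \<alpha> i) / 2)" for i j
  define \<delta> where "\<delta> i = \<alpha>' i - \<alpha> i" for i
  have K_sym: "K j i = K i j" and c_sym: "c j i = - c i j" for i j
    using sin_minus[of "(\<alpha> j - \<alpha> i) / 2"] cot_minus[of "(\<alpha> j - \<alpha> i) / 2"]
    by (simp_all add: K_def c_def chord_def minus_divide_left)
  have rad: "(\<Sum>j\<in>I - {i}. m j * K i j) = 4 * B\<^sup>2 * \<rho>\<^sup>2"
    and tan: "(\<Sum>j\<in>I - {i}. m j * K i j * c i j) = 0" if "i \<in> I" for i
    using assms(2) that by (simp_all add: balanced_def K_def c_def)
  have R: "(\<Sum>i\<in>I. \<Sum>j\<in>I - {i}. m i * m j * K i j * (ln \<rho>' - ln \<rho>)) =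
      (ln \<rho>' - ln \<rho>) * (4 * B\<^sup>2 * \<rho>\<^sup>2) * sum m I"
  proof -
    have "(\<Sum>i\<in>I. \<Sum>j\<in>I - {i}. m i * m j * K i j * (ln \<rho>' - ln \<rho>)) =
        (\<Sum>i\<in>I. m i * (ln \<rho>' - ln \<rho>) * (\<Sum>j\<in>I - {i}. m j * K i j))"
      by (simp add: sum_distrib_left mult_ac)
    also have "\<dots> = (\<Sum>i\<in>I. (ln \<rho>' - ln \<rho>) * (4 * B\<^sup>2 * \<rho>\<^sup>2) * m i)"
      by (intro sum.cong refl) (simp add: rad)
    finally show ?thesis by (simp only: sum_distrib_left)
  qed
  have T1: "(\<Sum>i\<in>I. \<Sum>j\<in>I - {i}. m i * m j * K i j * c i j * \<delta> i) = 0"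
  proof -
    have "(\<Sum>i\<in>I. \<Sum>j\<in>I - {i}. m i * m j * K i j * c i j * \<delta> i) =
        (\<Sum>i\<in>I. m i * \<delta> i * (\<Sum>j\<in>I - {i}. m j * K i j * c i j))"
      by (simp add: sum_distrib_left mult_ac)
    then show ?thesis by (simp add: tan)
  qed
  \<comment> \<open>Exchanging \<open>i\<close> and \<open>j\<close> turns this sum into minus the
    one in \<open>T1\<close>, since \<open>K\<close> is symmetric and \<open>c\<close>
    antisymmetric.\<close>
  have T2: "(\<Sum>i\<in>I. \<Sum>j\<in>I - {i}. m i * m j * K i j * c i j * \<delta> j) = 0"
  proof -
    have "(\<Sum>i\<in>I. \<Sum>j\<in>I - {i}. m i * m j * K i j * c i j * \<delta> j) =
        (\<Sum>i\<in>I. \<Sum>j\<in>I - {i}. m j * m i * K j i * c j i * \<delta> i)"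
      by (rule sum_swap_off_diagonal[OF assms(1)])
    also have "\<dots> = (\<Sum>i\<in>I. \<Sum>j\<in>I - {i}. - (m i * m j * K i j * c i j * \<delta> i))"
    proof (intro sum.cong refl)
      fix i j
      show "m j * m i * K j i * c j i * \<delta> i = - (m i * m j * K i j * c i j * \<delta> i)"
        unfolding K_sym[of j i] c_sym[of j i] by simp
    qed
    finally show ?thesis using T1 by (simp only: sum_negf)
  qed
  have "(\<Sum>i\<in>I. \<Sum>j\<in>I - {i}. m i * m j * K i j * gap \<rho> \<alpha> \<rho>' \<alpha>' i j) =
    (\<Sum>i\<in>I. \<Sum>j\<in>I - {i}. m i * m j * K i j * (ln \<rho>' - ln \<rho>)) +
    (\<Sum>i\<in>I. \<Sum>j\<in>I - {i}. m i * m j * K i j * c i j * \<delta> j) / 2 -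
    (\<Sum>i\<in>I. \<Sum>j\<in>I - {i}. m i * m j * K i j * c i j * \<delta> i) / 2 -
    (\<Sum>i\<in>I. \<Sum>j\<in>I - {i}. m i * m j * K i j *
       (ln (chord \<rho>' \<alpha>' i j) - ln (chord \<rho> \<alpha> i j)))"
    unfolding sum.distrib[symmetric] sum_subtractf[symmetric] sum_divide_distrib
    by (intro sum.cong refl) (simp add: gap_def c_def \<delta>_def field_simps)
  then show ?thesis unfolding R T1 T2 by (simp add: K_def)
qed

text \<open>Comparing the linearisations at both configurations is the monotonicity of the gradient
  of a convex function. It equates a nonnegative sum over pairs with a nonpositive radial term, so
  both vanish; the equality cases then fix the radius and the angle differences.\<close>

lemma balanced_unique:
  assumes fin: "finite I" and ne: "I \<noteq> {}" and m: "\<And>i. i \<in> I \<Longrightarrow> m i > 0" and B: "B > 0"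
    and bal: "balanced I m B \<rho> \<alpha>" and bal': "balanced I m B \<rho>' \<alpha>'"
    and ord: "same_order I \<alpha> \<alpha>'"
  shows "\<rho> = \<rho>'" and "\<lbrakk>i \<in> I; j \<in> I\<rbrakk> \<Longrightarrow> \<alpha> j - \<alpha> i = \<alpha>' j - \<alpha>' i"
proof -
  note ord' = same_order_sym[OF ord]
  have \<rho>: "\<rho> > 0" "\<rho>' > 0" using bal bal' by (simp_all add: balanced_def)
  define L where "L i j = ln (chord \<rho>' \<alpha>' i j) - ln (chord \<rho> \<alpha> i j)" for i j
  define K where "K i j = kap (chord \<rho> \<alpha> i j)" for i j
  define K' where "K' i j = kap (chord \<rho>' \<alpha>' i j)" for i j
  define g where "g i j = gap \<rho> \<alpha> \<rho>' \<alpha>' i j" for i j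
  define g' where "g' i j = gap \<rho>' \<alpha>' \<rho> \<alpha> i j" for i j
  \<comment> \<open>Three nonnegative contributions of a pair: the concavity defects seen from
    either configuration, and the monotonicity of \<open>kap\<close> against the logarithm.\<close>
  define W where "W i j = K i j * g i j + K' i j * g' i j + (K i j - K' i j) * L i j" for i j
  have K: "K i j > 0" "K' i j > 0" and g: "g i j \<ge> 0" "g' i j \<ge> 0"
    and KL: "(K i j - K' i j) * L i j \<ge> 0"
    and KL0: "(K i j - K' i j) * L i j = 0 \<Longrightarrow> chord \<rho> \<alpha> i j = chord \<rho>' \<alpha>' i j"
    if ij: "i \<in> I" "j \<in> I - {i}" for i j
  proof -
    have c: "chord \<rho> \<alpha> i j > 0" "chord \<rho>' \<alpha>' i j > 0"
      using chord_pos[OF ord ij \<rho>(1)] chord_pos[OF ord' ij \<rho>(2)] .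
    show "K i j > 0" "K' i j > 0" using c by (simp_all add: K_def K'_def kap_pos)
    show "g i j \<ge> 0" "g' i j \<ge> 0"
      unfolding g_def g'_def using gap_nonneg[OF ord ij \<rho>] gap_nonneg[OF ord' ij \<rho>(2,1)] .
    show "(K i j - K' i j) * L i j \<ge> 0"
      "(K i j - K' i j) * L i j = 0 \<Longrightarrow> chord \<rho> \<alpha> i j = chord \<rho>' \<alpha>' i j"
      unfolding K_def K'_def L_def using kap_ln_monotone[OF c] by blast+
  qed
  have W: "W i j \<ge> 0" if "i \<in> I" "j \<in> I - {i}" for i j
    unfolding W_def using K[OF that] g[OF that] KL[OF that] by simp
  have "(\<Sum>i\<in>I. \<Sum>j\<in>I - {i}. m i * m j * W i j) =
      (\<Sum>i\<in>I. \<Sum>j\<in>I - {i}. m i * m j * K i j * g i j) +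
      (\<Sum>i\<in>I. \<Sum>j\<in>I - {i}. m i * m j * K' i j * g' i j) +
      (\<Sum>i\<in>I. \<Sum>j\<in>I - {i}. m i * m j * K i j * L i j) +
      (\<Sum>i\<in>I. \<Sum>j\<in>I - {i}. m i * m j * K' i j * (- L i j))"
    unfolding sum.distrib[symmetric]
    by (intro sum.cong refl) (simp add: W_def algebra_simps)
  \<comment> \<open>The sums with \<open>L\<close> cancel against those subtracted in the two
    instances of \<open>sum_gap\<close>; only the radial terms survive.\<close>
  also have "\<dots> = - ((ln \<rho>' - ln \<rho>) * (\<rho>'\<^sup>2 - \<rho>\<^sup>2) * (4 * B\<^sup>2 * sum m I))"
    using sum_gap[OF fin bal, of \<rho>' \<alpha>'] sum_gap[OF fin bal', of \<rho> \<alpha>]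
    unfolding K_def K'_def g_def g'_def L_def minus_diff_eq by (simp add: algebra_simps)
  finally have eq: "(\<Sum>i\<in>I. \<Sum>j\<in>I - {i}. m i * m j * W i j) =
      - ((ln \<rho>' - ln \<rho>) * (\<rho>'\<^sup>2 - \<rho>\<^sup>2) * (4 * B\<^sup>2 * sum m I))" .
  have mW: "m i * m j * W i j \<ge> 0" if "i \<in> I" "j \<in> I - {i}" for i j
    using W[OF that] m that by (simp add: less_imp_le)
  have pos: "4 * B\<^sup>2 * sum m I > 0" using B fin ne m by (simp add: sum_pos)
  have "(\<Sum>i\<in>I. \<Sum>j\<in>I - {i}. m i * m j * W i j) \<ge> 0"
    using mW by (intro sum_nonneg) auto
  with eq pos have le: "(ln \<rho>' - ln \<rho>) * (\<rho>'\<^sup>2 - \<rho>\<^sup>2) \<le> 0"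
    by (metis linorder_not_less mult_pos_pos neg_less_0_iff_less)
  show \<rho>_eq: "\<rho> = \<rho>'"
  proof (rule ccontr)
    assume "\<rho> \<noteq> \<rho>'"
    then consider "\<rho> < \<rho>'" | "\<rho>' < \<rho>" by linarith
    then have "(ln \<rho>' - ln \<rho>) * (\<rho>'\<^sup>2 - \<rho>\<^sup>2) > 0"
    proof cases
      case 1
      then show ?thesis using \<rho> by (intro mult_pos_pos) (auto simp: power_strict_mono)
    next
      case 2
      then show ?thesis using \<rho> by (intro mult_neg_neg) (auto simp: power_strict_mono)
    qed
    with le show False by simp
  qed
  \<comment> \<open>For equal radii the radial term is zero, which forces every nonnegative summand
    to vanish.\<close>
  have sum0: "(\<Sum>i\<in>I. \<Sum>j\<in>I - {i}. m i * m j * W i j) = 0"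
    unfolding eq \<rho>_eq by simp
  have W0: "W i j = 0" if ij: "i \<in> I" "j \<in> I - {i}" for i j
  proof -
    have "(\<Sum>j\<in>I - {i}. m i * m j * W i j) = 0"
      using sum0 fin mW ij(1) by (subst (asm) sum_nonneg_eq_0_iff) (auto intro!: sum_nonneg)
    then have "m i * m j * W i j = 0"
      using fin mW ij by (subst (asm) sum_nonneg_eq_0_iff) auto
    with m[OF ij(1)] m[of j] ij show ?thesis by auto
  qed
  show "\<alpha> j - \<alpha> i = \<alpha>' j - \<alpha>' i" if i: "i \<in> I" and j: "j \<in> I"
  proof (cases "i = j")
    case False
    with j have ij: "i \<in> I" "j \<in> I - {i}" using i by auto
    let ?d = "\<alpha> j - \<alpha> i" and ?e = "\<alpha>' j - \<alpha>' i"
    have "K i j * g i j \<ge> 0" "K' i j * g' i j \<ge> 0"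
      using K[OF ij] g[OF ij] by simp_all
    with W0[OF ij] KL[OF ij] have z: "K i j * g i j = 0" "(K i j - K' i j) * L i j = 0"
      unfolding W_def by linarith+
    have ch: "chord \<rho> \<alpha> i j = chord \<rho>' \<alpha>' i j" using KL0[OF ij z(2)] .
    have "g i j = 0" using z(1) K(1)[OF ij] by simp
    \<comment> \<open>With equal radii and equal chords only the cotangent term of
      \<open>gap\<close> is left.\<close>
    then have "cot (?d / 2) * (?e - ?d) = 0"
      unfolding g_def gap_def using ch \<rho>_eq by (simp add: algebra_simps)
    then consider "?e = ?d" | "cot (?d / 2) = 0" by force
    then show ?thesis
    proof cases
      case 2
      text \<open>Opposite points: the tangent inequality is degenerate, but \<open>\<bar>sin\<bar>\<close> attains its maximum.\<close>
      have o: "(?d \<in> {0<..<2 * pi} \<and> ?e \<in> {0<..<2 * pi}) \<or>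
          (- ?d \<in> {0<..<2 * pi} \<and> - ?e \<in> {0<..<2 * pi})"
        using ord ij by (auto simp: same_order_def)
      have sn: "\<bar>sin (?d / 2)\<bar> = \<bar>sin (?e / 2)\<bar>" using ch \<rho> \<rho>_eq by (simp add: chord_def)
      have s0: "0 < \<bar>sin (?d / 2)\<bar>" using o abs_sin_half_pos by blast
      with 2 have cd: "cos (?d / 2) = 0" by (auto simp: cot_def)
      have "(sin (?d / 2))\<^sup>2 = (sin (?e / 2))\<^sup>2" using sn by (metis power2_abs)
      then have ce: "cos (?e / 2) = 0"
        using cd sin_cos_squared_add[of "?d / 2"] sin_cos_squared_add[of "?e / 2"] by simp
      have uniq: "x = pi" if "x \<in> {0<..<2 * pi}" "cos (x / 2) = 0" for x :: real
      proof -
        have "x / 2 = pi / 2"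
          using that by (subst cos_inj_pi[of "x / 2" "pi / 2"]) auto
        then show ?thesis by simp
      qed
      show ?thesis using o
      proof
        assume "?d \<in> {0<..<2 * pi} \<and> ?e \<in> {0<..<2 * pi}"
        then show ?thesis using uniq[of ?d] uniq[of ?e] cd ce by simp
      next
        assume *: "- ?d \<in> {0<..<2 * pi} \<and> - ?e \<in> {0<..<2 * pi}"
        have "cos (- ?d / 2) = 0" "cos (- ?e / 2) = 0"
          using cd ce by (simp_all only: minus_divide_left[symmetric] cos_minus)
        then show ?thesis using * uniq[of "- ?d"] uniq[of "- ?e"] by simp
      qed
    qed simp
  qed simp
qed

section \<open>Polar coordinates from the order of the masses\<close>

text \<open>Composing with \<open>inv \<tau>\<close> indexes the angles by bodies instead of
  positions. The rotation is undone by subtracting \<open>\<theta>\<close> without reduction modulo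
  \<open>2 * pi\<close>, so angle differences are preserved.\<close>

lemma mass_order_polar:
  assumes "mass_order n \<tau> P" "\<tau> permutes {1..n}"
  obtains \<theta> \<rho> \<gamma> where "\<rho> > 0" "\<And>i. i \<in> {1..n} \<Longrightarrow> \<gamma> i \<in> {0..<2 * pi}"
    "\<And>i. i \<in> {1..n} \<Longrightarrow> P i = \<rho> *\<^sub>R vector [cos (\<gamma> i - \<theta>), sin (\<gamma> i - \<theta>)]"
    "\<And>i j. \<lbrakk>i \<in> {1..n}; j \<in> {1..n}\<rbrakk> \<Longrightarrow> \<gamma> i < \<gamma> j \<longleftrightarrow> inv \<tau> i < inv \<tau> j"
proof -
  obtain \<theta> \<rho> \<gamma> where \<rho>: "\<rho> > 0" and mono: "strict_mono_on {1..n} \<gamma>"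
    and P: "\<And>k. k \<in> {1..n} \<Longrightarrow> T \<theta> *v P (\<tau> k) = \<rho> *\<^sub>R vector [cos (\<gamma> k), sin (\<gamma> k)]"
    and rng: "\<And>k. k \<in> {1..n} \<Longrightarrow> 0 \<le> \<gamma> k \<and> \<gamma> k < 2 * pi"
    using assms(1) unfolding mass_order_def by blast
  have inv: "inv \<tau> i \<in> {1..n}" "\<tau> (inv \<tau> i) = i" if "i \<in> {1..n}" for i
    using that permutes_in_image[OF permutes_inv[OF assms(2)]] permutes_inverses(1)[OF assms(2)]
    by blast+
  show thesis
  proof (rule that[of \<rho> "\<lambda>i. \<gamma> (inv \<tau> i)" \<theta>, OF \<rho>])
    fix i assume i: "i \<in> {1..n}"
    show "\<gamma> (inv \<tau> i) \<in> {0..<2 * pi}" using rng[OF inv(1)[OF i]] by simp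
    let ?x = "P i $ 1" and ?y = "P i $ 2" and ?g = "\<gamma> (inv \<tau> i)"
    have "T \<theta> *v P i = \<rho> *\<^sub>R vector [cos ?g, sin ?g]"
      using P[OF inv(1)[OF i]] inv(2)[OF i] by simp
    then have *: "cos \<theta> * ?x - sin \<theta> * ?y = \<rho> * cos ?g" "sin \<theta> * ?x + cos \<theta> * ?y = \<rho> * sin ?g"
      by (simp_all add: vec_eq_iff forall_2 matrix_vector_mult_def sum_2 T_def)
    have sc: "(sin \<theta>)\<^sup>2 + (cos \<theta>)\<^sup>2 = 1" by simp
    have x: "?x = \<rho> * cos (?g - \<theta>)"
      unfolding cos_diff using * sc by algebra
    have y: "?y = \<rho> * sin (?g - \<theta>)"
      unfolding sin_diff using * sc by algebra
    show "P i = \<rho> *\<^sub>R vector [cos (?g - \<theta>), sin (?g - \<theta>)]"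
      using x y by (simp add: vec_eq_iff forall_2)
  next
    fix i j assume "i \<in> {1..n}" "j \<in> {1..n}"
    then show "\<gamma> (inv \<tau> i) < \<gamma> (inv \<tau> j) \<longleftrightarrow> inv \<tau> i < inv \<tau> j"
      using strict_mono_on_less[OF mono] inv(1) by blast
  qed
qed

section \<open>Reduction of the equations of motion\<close>

lemma has_vector_derivative_vec_nth:
  fixes f :: "real \<Rightarrow> real ^ 'n"
  assumes "(f has_vector_derivative f') (at t)"
  shows "((\<lambda>t. f t $ k) has_real_derivative f' $ k) (at t)"
  using bounded_linear.has_vector_derivative[OF bounded_linear_vec_nth assms, of k]
  by (simp add: has_real_derivative_iff_has_vector_derivative)

text \<open>For \<open>S = sinh (r / 2)\<close> the base is \<open>(sinh r)\<^sup>2\<close>, so this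
  is the factor \<open>(sinh r) ^ 3\<close> in the denominator of the force.\<close>

lemma force_denominator:
  fixes S :: real
  assumes "S > 0"
  shows "(4 * S\<^sup>2 * (1 + S\<^sup>2)) powr (3 / 2) = 8 * S ^ 3 * (1 + S\<^sup>2) powr (3 / 2)"
proof -
  have "(4 * S\<^sup>2) powr (3 / 2) = ((2 * S) powr 2) powr (3 / 2)"
    using assms by (simp add: powr_numeral power_mult_distrib)
  also have "\<dots> = (2 * S) ^ 3"
    unfolding powr_powr using assms by (simp add: powr_numeral)
  finally show ?thesis by (simp add: powr_mult power_mult_distrib)
qed

text \<open>At time \<open>0\<close>, the third component of the equation of motion gives the radial
  balance, and the horizontal component tangent to the circle gives the cotangent balance.\<close>

lemma rel_eq_balanced:
  assumes rel: "polygonal_rel_eq n (- 1) m B P z p" and \<rho>: "\<rho> > 0" and n: "n \<ge> 1"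
    and P: "\<And>i. i \<in> {1..n} \<Longrightarrow> P i = \<rho> *\<^sub>R vector [cos (\<alpha> i), sin (\<alpha> i)]"
    and sin0: "\<And>i j. \<lbrakk>i \<in> {1..n}; j \<in> {1..n} - {i}\<rbrakk> \<Longrightarrow> sin ((\<alpha> j - \<alpha> i) / 2) \<noteq> 0"
  shows "z\<^sup>2 = 1 + \<rho>\<^sup>2" "balanced {1..n} m B \<rho> \<alpha>"
proof -
  let ?s = "- 1 :: real"
  have sol: "solution n ?s m p" and p: "\<And>i t. i \<in> {1..n} \<Longrightarrow> p i t = stack (T (B * t) *v P i) z"
    using rel by (auto simp: polygonal_rel_eq_def)
  have c: "p i t $ 1 = \<rho> * cos (\<alpha> i + B * t)" "p i t $ 2 = \<rho> * sin (\<alpha> i + B * t)" "p i t $ 3 = z"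
    if "i \<in> {1..n}" for i t
    using p[OF that] P[OF that]
    by (simp_all add: stack_def matrix_vector_mult_def sum_2 T_def cos_add sin_add algebra_simps)
  show z2: "z\<^sup>2 = 1 + \<rho>\<^sup>2"
  proof -
    have 1: "(1::nat) \<in> {1..n}" using n by simp
    have "p 1 0 \<in> M2 ?s" using sol 1 unfolding solution_def by blast
    then have "(\<rho> * cos (\<alpha> 1))\<^sup>2 + (\<rho> * sin (\<alpha> 1))\<^sup>2 - z\<^sup>2 = - 1"
      using c[OF 1, of 0] by (simp add: M2_def)
    with sin_cos_squared_add2[of "\<alpha> 1"] show ?thesis by algebra
  qed
  then have z0: "z \<noteq> 0" by auto
  obtain v a where "\<forall>i\<in>{1..n}. \<forall>t.
       (p i has_vector_derivative v i t) (at t) \<and>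
       (v i has_vector_derivative a i t) (at t) \<and>
       a i t =
         (\<Sum>j\<in>{1..n} - {i}.
            (m j / (?s - ?s * (odot ?s (p i t) (p j t))\<^sup>2) powr (3 / 2)) *\<^sub>R
            (p j t - (?s * odot ?s (p i t) (p j t)) *\<^sub>R p i t))
         - (?s * odot ?s (v i t) (v i t)) *\<^sub>R p i t"
    using sol unfolding solution_def by (elim conjE exE) (erule that)
  note va = this[rule_format]
  have v: "v i t $ 1 = - \<rho> * B * sin (\<alpha> i + B * t)" "v i t $ 2 = \<rho> * B * cos (\<alpha> i + B * t)"
    "v i t $ 3 = 0" if i: "i \<in> {1..n}" for i t
  proof -
    note D = has_vector_derivative_vec_nth[of "p i" "v i t" t]
    have d: "(p i has_vector_derivative v i t) (at t)" using va[OF i] by blast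
    have "((\<lambda>t. \<rho> * cos (\<alpha> i + B * t)) has_real_derivative v i t $ 1) (at t)"
      using D[OF d, of 1] c[OF i] by simp
    moreover have "((\<lambda>t. \<rho> * cos (\<alpha> i + B * t)) has_real_derivative - \<rho> * B * sin (\<alpha> i + B * t)) (at t)"
      by (auto intro!: derivative_eq_intros)
    ultimately show "v i t $ 1 = - \<rho> * B * sin (\<alpha> i + B * t)" by (rule DERIV_unique)
    have "((\<lambda>t. \<rho> * sin (\<alpha> i + B * t)) has_real_derivative v i t $ 2) (at t)"
      using D[OF d, of 2] c[OF i] by simp
    moreover have "((\<lambda>t. \<rho> * sin (\<alpha> i + B * t)) has_real_derivative \<rho> * B * cos (\<alpha> i + B * t)) (at t)"
      by (auto intro!: derivative_eq_intros)
    ultimately show "v i t $ 2 = \<rho> * B * cos (\<alpha> i + B * t)" by (rule DERIV_unique)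
    have "((\<lambda>t. z) has_real_derivative v i t $ 3) (at t)"
      using D[OF d, of 3] c[OF i] by simp
    then show "v i t $ 3 = 0" using DERIV_const DERIV_unique by blast
  qed
  have a: "a i t $ 1 = - \<rho> * B\<^sup>2 * cos (\<alpha> i + B * t)" "a i t $ 2 = - \<rho> * B\<^sup>2 * sin (\<alpha> i + B * t)"
    "a i t $ 3 = 0" if i: "i \<in> {1..n}" for i t
  proof -
    note D = has_vector_derivative_vec_nth[of "v i" "a i t" t]
    have d: "(v i has_vector_derivative a i t) (at t)" using va[OF i] by blast
    have "((\<lambda>t. - \<rho> * B * sin (\<alpha> i + B * t)) has_real_derivative a i t $ 1) (at t)"
      using D[OF d, of 1] v[OF i] by simp
    moreover have "((\<lambda>t. - \<rho> * B * sin (\<alpha> i + B * t)) has_real_derivative - \<rho> * B\<^sup>2 * cos (\<alpha> i + B * t)) (at t)"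
      by (auto intro!: derivative_eq_intros simp: power2_eq_square)
    ultimately show "a i t $ 1 = - \<rho> * B\<^sup>2 * cos (\<alpha> i + B * t)" by (rule DERIV_unique)
    have "((\<lambda>t. \<rho> * B * cos (\<alpha> i + B * t)) has_real_derivative a i t $ 2) (at t)"
      using D[OF d, of 2] v[OF i] by simp
    moreover have "((\<lambda>t. \<rho> * B * cos (\<alpha> i + B * t)) has_real_derivative - \<rho> * B\<^sup>2 * sin (\<alpha> i + B * t)) (at t)"
      by (auto intro!: derivative_eq_intros simp: power2_eq_square)
    ultimately show "a i t $ 2 = - \<rho> * B\<^sup>2 * sin (\<alpha> i + B * t)" by (rule DERIV_unique)
    have "((\<lambda>t. 0) has_real_derivative a i t $ 3) (at t)"
      using D[OF d, of 3] v[OF i] by simp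
    then show "a i t $ 3 = 0" using DERIV_const DERIV_unique by blast
  qed
  have "(\<Sum>j\<in>{1..n} - {i}. m j * kap (chord \<rho> \<alpha> i j)) = 4 * B\<^sup>2 * \<rho>\<^sup>2 \<and>
    (\<Sum>j\<in>{1..n} - {i}. m j * kap (chord \<rho> \<alpha> i j) * cot ((\<alpha> j - \<alpha> i) / 2)) = 0"
    if i: "i \<in> {1..n}" for i
  proof -
    define S where "S j = chord \<rho> \<alpha> i j" for j
    define o' where "o' j = odot ?s (p i 0) (p j 0)" for j
    define F where "F j = m j / (?s - ?s * (o' j)\<^sup>2) powr (3 / 2)" for j
    have vv: "odot ?s (v i 0) (v i 0) = \<rho>\<^sup>2 * B\<^sup>2"
    proof -
      have "odot ?s (v i 0) (v i 0) = (\<rho> * B * sin (\<alpha> i))\<^sup>2 + (\<rho> * B * cos (\<alpha> i))\<^sup>2"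
        by (simp add: odot_def v[OF i] power2_eq_square)
      with sin_cos_squared_add[of "\<alpha> i"] show ?thesis by algebra
    qed
    have eqn: "a i 0 = (\<Sum>j\<in>{1..n} - {i}. F j *\<^sub>R (p j 0 + o' j *\<^sub>R p i 0)) + (\<rho>\<^sup>2 * B\<^sup>2) *\<^sub>R p i 0"
      using va[OF i, of 0] vv by (simp add: F_def o'_def)
    \<comment> \<open>Here \<open>o' j\<close> is minus the hyperbolic cosine of the distance,
      written through the half distance as \<open>1 + 2 * (sinh (r / 2))\<^sup>2\<close>.\<close>
    have o': "o' j = - (1 + 2 * (S j)\<^sup>2)" and S: "S j > 0"
      and sd: "\<rho>\<^sup>2 * sin (\<alpha> j - \<alpha> i) = 2 * (S j)\<^sup>2 * cot ((\<alpha> j - \<alpha> i) / 2)"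
      if j: "j \<in> {1..n} - {i}" for j
    proof -
      let ?h = "(\<alpha> j - \<alpha> i) / 2"
      have j': "j \<in> {1..n}" using j by simp
      have S2: "(S j)\<^sup>2 = \<rho>\<^sup>2 * (sin ?h)\<^sup>2"
        by (simp add: S_def chord_def power_mult_distrib)
      have double: "2 * ?h = \<alpha> j - \<alpha> i" by simp
      have "o' j = \<rho>\<^sup>2 * cos (\<alpha> j - \<alpha> i) - z\<^sup>2"
        by (simp add: o'_def odot_def c[OF i] c[OF j'] cos_diff power2_eq_square algebra_simps)
      also have "\<dots> = \<rho>\<^sup>2 * cos (2 * ?h) - z\<^sup>2"
        by (simp only: double)
      also have "\<dots> = - (1 + 2 * (S j)\<^sup>2)"
        unfolding cos_double_sin z2 S2 by (simp add: algebra_simps)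
      finally show "o' j = - (1 + 2 * (S j)\<^sup>2)" .
      show "S j > 0" using sin0[OF i j] \<rho> by (simp add: S_def chord_def)
      have "sin (\<alpha> j - \<alpha> i) = 2 * sin ?h * cos ?h"
        using sin_double[of ?h] by (simp only: double)
      then show "\<rho>\<^sup>2 * sin (\<alpha> j - \<alpha> i) = 2 * (S j)\<^sup>2 * cot ?h"
        unfolding S2 cot_def using sin0[OF i j] by (simp add: power2_eq_square)
    qed
    \<comment> \<open>The factor \<open>2 * (S j)\<^sup>2\<close> arises in both components: from
      \<open>1 + o' j\<close> in the vertical one and from \<open>sd\<close> in the tangential
      one.\<close>
    have F: "F j * (2 * (S j)\<^sup>2) = m j * kap (S j) / 4" if j: "j \<in> {1..n} - {i}" for j
    proof -
      have "?s - ?s * (o' j)\<^sup>2 = 4 * (S j)\<^sup>2 * (1 + (S j)\<^sup>2)"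
        unfolding o'[OF j] by (simp add: power2_eq_square algebra_simps)
      then have "F j = m j / (8 * S j ^ 3 * (1 + (S j)\<^sup>2) powr (3 / 2))"
        using force_denominator[OF S[OF j]] by (simp add: F_def)
      then show ?thesis using S[OF j]
        by (simp add: kap_def power2_eq_square power3_eq_cube)
    qed
    \<comment> \<open>The bodies stay at height \<open>z\<close>, so the vertical acceleration is
      zero; the common factor \<open>z\<close> is later cancelled using \<open>z0\<close>.\<close>
    have "0 = (\<Sum>j\<in>{1..n} - {i}. F j * (p j 0 $ 3 + o' j * z)) + \<rho>\<^sup>2 * B\<^sup>2 * z"
      using arg_cong[OF eqn, of "\<lambda>x. x $ 3"] by (simp add: a[OF i] c[OF i])
    also have "(\<Sum>j\<in>{1..n} - {i}. F j * (p j 0 $ 3 + o' j * z)) =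
        (\<Sum>j\<in>{1..n} - {i}. - (z / 4) * (m j * kap (S j)))"
    proof (intro sum.cong refl)
      fix j assume j: "j \<in> {1..n} - {i}"
      then have j': "j \<in> {1..n}" by simp
      have "F j * (p j 0 $ 3 + o' j * z) = - z * (F j * (2 * (S j)\<^sup>2))"
        unfolding o'[OF j] c(3)[OF j'] by (simp add: algebra_simps)
      then show "F j * (p j 0 $ 3 + o' j * z) = - (z / 4) * (m j * kap (S j))"
        unfolding F[OF j] by simp
    qed
    also have "\<dots> = - (z / 4) * (\<Sum>j\<in>{1..n} - {i}. m j * kap (S j))"
      by (simp only: sum_distrib_left)
    finally have "z * (\<Sum>j\<in>{1..n} - {i}. m j * kap (S j)) = z * (4 * B\<^sup>2 * \<rho>\<^sup>2)"
      by (simp add: algebra_simps)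
    with z0 have radial: "(\<Sum>j\<in>{1..n} - {i}. m j * kap (S j)) = 4 * B\<^sup>2 * \<rho>\<^sup>2"
      by simp
    \<comment> \<open>Up to the factor \<open>\<rho>\<close>, this is the component along the circle
      at body \<open>i\<close>. It annihilates both the position and the centripetal acceleration of
      that body, leaving only the attractions.\<close>
    let ?t = "\<lambda>x :: real ^ 3. \<rho> * (cos (\<alpha> i) * x $ 2 - sin (\<alpha> i) * x $ 1)"
    have lin: "?t (x + y) = ?t x + ?t y" "?t (r *\<^sub>R x) = r * ?t x" for x y r
      by (simp_all add: algebra_simps)
    have lin_sum: "?t (sum f J) = (\<Sum>j\<in>J. ?t (f j))" if "finite J" for f and J :: "nat set"
      using that by induction (simp_all add: algebra_simps)
    have "?t (a i 0) = 0" "?t (p i 0) = 0"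
      by (simp_all add: a[OF i] c[OF i])
    with arg_cong[OF eqn, of ?t] have "0 = (\<Sum>j\<in>{1..n} - {i}. F j * ?t (p j 0))"
      unfolding lin lin_sum[OF finite_Diff[OF finite_atLeastAtMost]] by simp
    also have "\<dots> = (\<Sum>j\<in>{1..n} - {i}. (1 / 4) * (m j * kap (S j) * cot ((\<alpha> j - \<alpha> i) / 2)))"
    proof (intro sum.cong refl)
      fix j assume j: "j \<in> {1..n} - {i}"
      then have j': "j \<in> {1..n}" by simp
      have "?t (p j 0) = \<rho>\<^sup>2 * sin (\<alpha> j - \<alpha> i)"
        by (simp add: c[OF j'] sin_diff power2_eq_square algebra_simps)
      then have "F j * ?t (p j 0) = (F j * (2 * (S j)\<^sup>2)) * cot ((\<alpha> j - \<alpha> i) / 2)"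
        unfolding sd[OF j] by simp
      then show "F j * ?t (p j 0) = (1 / 4) * (m j * kap (S j) * cot ((\<alpha> j - \<alpha> i) / 2))"
        unfolding F[OF j] by simp
    qed
    also have "\<dots> = (1 / 4) * (\<Sum>j\<in>{1..n} - {i}. m j * kap (S j) * cot ((\<alpha> j - \<alpha> i) / 2))"
      by (simp only: sum_distrib_left)
    finally show ?thesis using radial by (simp add: S_def)
  qed
  then show "balanced {1..n} m B \<rho> \<alpha>" using \<rho> by (simp add: balanced_def)
qed

section \<open>Uniqueness up to rotation for a given order of the masses\<close>

theorem theorem1p2:
  fixes n :: nat and \<sigma> B z z' :: real and m :: "nat \<Rightarrow> real" and \<tau> :: "nat \<Rightarrow> nat"
    and P P' :: "nat \<Rightarrow> real ^ 2" and p p' :: "nat \<Rightarrow> real \<Rightarrow> real ^ 3"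
  assumes "n \<ge> 2" and "\<sigma> = -1" and "B > 0" and "\<And>i. i \<in> {1..n} \<Longrightarrow> m i > 0"
    and "\<tau> permutes {1..n}"
    and "polygonal_rel_eq n \<sigma> m B P z p" and "mass_order n \<tau> P"
    and "polygonal_rel_eq n \<sigma> m B P' z' p'" and "mass_order n \<tau> P'"
    and "same_sheet z z'"
  shows "equivalent n p p'"
proof -
  obtain \<theta> \<rho> \<gamma> where \<rho>: "\<rho> > 0" and \<gamma>: "\<And>i. i \<in> {1..n} \<Longrightarrow> \<gamma> i \<in> {0..<2 * pi}"
    and P: "\<And>i. i \<in> {1..n} \<Longrightarrow> P i = \<rho> *\<^sub>R vector [cos (\<gamma> i - \<theta>), sin (\<gamma> i - \<theta>)]"
    and mono: "\<And>i j. \<lbrakk>i \<in> {1..n}; j \<in> {1..n}\<rbrakk> \<Longrightarrow> \<gamma> i < \<gamma> j \<longleftrightarrow> inv \<tau> i < inv \<tau> j"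
    using mass_order_polar[OF assms(7,5)] by metis
  obtain \<theta>' \<rho>' \<gamma>' where \<rho>': "\<rho>' > 0" and \<gamma>': "\<And>i. i \<in> {1..n} \<Longrightarrow> \<gamma>' i \<in> {0..<2 * pi}"
    and P': "\<And>i. i \<in> {1..n} \<Longrightarrow> P' i = \<rho>' *\<^sub>R vector [cos (\<gamma>' i - \<theta>'), sin (\<gamma>' i - \<theta>')]"
    and mono': "\<And>i j. \<lbrakk>i \<in> {1..n}; j \<in> {1..n}\<rbrakk> \<Longrightarrow> \<gamma>' i < \<gamma>' j \<longleftrightarrow> inv \<tau> i < inv \<tau> j"
    using mass_order_polar[OF assms(9,5)] by metis
  define \<alpha> where "\<alpha> i = \<gamma> i - \<theta>" for i
  define \<alpha>' where "\<alpha>' i = \<gamma>' i - \<theta>'" for i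
  have P_polar: "P i = \<rho> *\<^sub>R vector [cos (\<alpha> i), sin (\<alpha> i)]"
    "P' i = \<rho>' *\<^sub>R vector [cos (\<alpha>' i), sin (\<alpha>' i)]" if "i \<in> {1..n}" for i
    using P P' that by (simp_all add: \<alpha>_def \<alpha>'_def)
  \<comment> \<open>All \<open>\<gamma>\<close> lie within one turn, and in both configurations the
    sign of a difference is decided by \<open>inv \<tau>\<close>.\<close>
  have ord: "same_order {1..n} \<alpha> \<alpha>'"
    unfolding same_order_def
  proof (intro ballI)
    fix i j assume i: "i \<in> {1..n}" and "j \<in> {1..n} - {i}"
    then have j: "j \<in> {1..n}" and "i \<noteq> j" by auto
    then have "inv \<tau> i \<noteq> inv \<tau> j"
      using permutes_inj[OF permutes_inv[OF assms(5)]] by (auto dest: injD)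
    then consider "inv \<tau> i < inv \<tau> j" | "inv \<tau> j < inv \<tau> i" by linarith
    then show "(\<alpha> j - \<alpha> i \<in> {0<..<2 * pi} \<and> \<alpha>' j - \<alpha>' i \<in> {0<..<2 * pi}) \<or>
       (\<alpha> i - \<alpha> j \<in> {0<..<2 * pi} \<and> \<alpha>' i - \<alpha>' j \<in> {0<..<2 * pi})"
      using mono[OF i j] mono[OF j i] mono'[OF i j] mono'[OF j i]
        \<gamma>[OF i] \<gamma>[OF j] \<gamma>'[OF i] \<gamma>'[OF j]
      by cases (auto simp: \<alpha>_def \<alpha>'_def)
  qed
  \<comment> \<open>Chords of radius \<open>1\<close> are the absolute sines themselves, so positive
    chords give nonzero sines.\<close>
  have sin0: "sin ((\<alpha> j - \<alpha> i) / 2) \<noteq> 0" "sin ((\<alpha>' j - \<alpha>' i) / 2) \<noteq> 0"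
    if "i \<in> {1..n}" "j \<in> {1..n} - {i}" for i j
    using chord_pos[OF ord that, of 1] chord_pos[OF same_order_sym[OF ord] that, of 1]
    by (auto simp: chord_def)
  have n: "n \<ge> 1" using assms(1) by simp
  have bal: "z\<^sup>2 = 1 + \<rho>\<^sup>2" "balanced {1..n} m B \<rho> \<alpha>"
    using rel_eq_balanced[OF assms(6)[unfolded assms(2)] \<rho> n P_polar(1)] sin0 by blast+
  have bal': "z'\<^sup>2 = 1 + \<rho>'\<^sup>2" "balanced {1..n} m B \<rho>' \<alpha>'"
    using rel_eq_balanced[OF assms(8)[unfolded assms(2)] \<rho>' n P_polar(2)] sin0 by blast+
  have ne: "{1..n} \<noteq> {}" using n by simp
  note uniq = balanced_unique[OF finite_atLeastAtMost ne assms(4,3) bal(2) bal'(2) ord]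
  have \<rho>_eq: "\<rho>' = \<rho>" using uniq(1) by simp
  \<comment> \<open>Equal radii determine the height up to sign. As \<open>z\<close> is nonzero, the
    sheet determines the sign.\<close>
  have z_eq: "z' = z"
  proof -
    have "z\<^sup>2 = z'\<^sup>2" using bal(1) bal'(1) \<rho>_eq by simp
    moreover have "z \<noteq> 0" using bal(1) by auto
    ultimately show ?thesis using assms(10) by (auto simp: same_sheet_def power2_eq_iff)
  qed
  \<comment> \<open>Body \<open>1\<close> serves as reference: equal angle differences make its
    angular shift the shift of every body.\<close>
  define c where "c = \<alpha>' 1 - \<alpha> 1"
  have rot: "\<alpha>' i = \<alpha> i + c" if "i \<in> {1..n}" for i
    using uniq(2)[of 1 i] that n by (simp add: c_def)
  have "p' i t = T3 c *v p i t" if i: "i \<in> {1..n}" for i t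
  proof -
    have p: "p i t = stack (T (B * t) *v P i) z" "p' i t = stack (T (B * t) *v P' i) z"
      using assms(6,8) i z_eq by (simp_all add: polygonal_rel_eq_def)
    show ?thesis
      unfolding p P_polar[OF i] \<rho>_eq rot[OF i] cos_add sin_add
      by (simp add: vec_eq_iff forall_3 matrix_vector_mult_def sum_3 sum_2 T3_def stack_def T_def
          algebra_simps)
  qed
  then show ?thesis unfolding equivalent_def by blast
qed

end
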